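(* Let $G$ be a graph with $n$ vertices and $m$ edges, let $S$ be an $n \times n$ grid point set, and let $0 < \varepsilon < \frac{\pi}{2}$. Then for every bijection $\mu$ from the vertex set of $G$ to $S$ (in particular, also when the bijection may be chosen freely), $G$ admits a $\mu$-respecting $(\frac{\pi}{2} - \varepsilon)$AC$_2$ embedding on $S$ within area $O(n(m + \cot \varepsilon)) = O(n(m + 1/\varepsilon^2))$.
   Context: An $n \times n$ grid point set is a set $S$ of $n$ points with integer coordinates in $\{1,\dots,n\}^2$ such that no two points of $S$ lie on a common horizontal or a common vertical line. A $\mu$-respecting embedding of $G$ on $S$ places each vertex $v$ at $\mu(v)$ and draws each edge as a polygonal chain between its endpoints' points whose bends lie on points with integer coordinates (segments need not be axis-parallel); edges may not overlap and may not pass through points representing other vertices. For $\alpha \in (0,\pi/2]$, it is an $\alpha$AC$_b$ embedding if every edge has at most $b$ bends and whenever two edges cross, the crossing angle is at least $\alpha$. The area is that of the bounding box of the drawing on the integer grid.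
   Formalization: The area bound is claimed only when n ≤ K(m + cot ε) + 1, for any fixed K, with a constant depending on K; without this it fails (m = 0, fixed ε: any drawing has area at least (n−1)²). The embedding itself is claimed for all graphs. *)

theory Defs
  imports "HOL-Analysis.Analysis"
begin

definition simple_graph :: "'a set \<Rightarrow> 'a set set \<Rightarrow> bool" where
  "simple_graph V E \<longleftrightarrow> finite V \<and> (\<forall>e\<in>E. e \<subseteq> V \<and> card e = 2)"

definition grid_point_set :: "nat \<Rightarrow> (int \<times> int) set \<Rightarrow> bool" where
  "grid_point_set n S \<longleftrightarrow>
     S \<subseteq> {1..int n} \<times> {1..int n} \<and> card S = n \<and>
     (\<forall>p\<in>S. \<forall>q\<in>S. p \<noteq> q \<longrightarrow> fst p \<noteq> fst q \<and> snd p \<noteq> snd q)"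

definition real_pt :: "int \<times> int \<Rightarrow> real \<times> real" where
  "real_pt p = (real_of_int (fst p), real_of_int (snd p))"

text \<open>A polygonal chain is the list of its corner points: first end, bends, last end.
  Hence all bends have integer coordinates.\<close>

definition chain_seg :: "(int \<times> int) list \<Rightarrow> nat \<Rightarrow> (real \<times> real) set" where
  "chain_seg ps i = closed_segment (real_pt (ps ! i)) (real_pt (ps ! Suc i))"

definition chain_dir :: "(int \<times> int) list \<Rightarrow> nat \<Rightarrow> real \<times> real" where
  "chain_dir ps i = real_pt (ps ! Suc i) - real_pt (ps ! i)"

definition num_segs :: "(int \<times> int) list \<Rightarrow> nat" where
  "num_segs ps = length ps - 1"

definition num_bends :: "(int \<times> int) list \<Rightarrow> nat" where
  "num_bends ps = length ps - 2"

definition chain :: "(int \<times> int) list \<Rightarrow> (real \<times> real) set" where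
  "chain ps = (\<Union>i<num_segs ps. chain_seg ps i)"

text \<open>The chain is a simple curve: it does not degenerate and does not meet itself.\<close>

definition simple_chain :: "(int \<times> int) list \<Rightarrow> bool" where
  "simple_chain ps \<longleftrightarrow> length ps \<ge> 2 \<and>
     (\<forall>i<num_segs ps. ps ! i \<noteq> ps ! Suc i) \<and>
     (\<forall>j<num_segs ps. \<forall>i<j.
        chain_seg ps i \<inter> chain_seg ps j = (if j = Suc i then {real_pt (ps ! j)} else {}))"

definition overlap :: "(real \<times> real) set \<Rightarrow> (real \<times> real) set \<Rightarrow> bool" where
  "overlap X Y \<longleftrightarrow> (\<exists>p q. p \<noteq> q \<and> closed_segment p q \<subseteq> X \<inter> Y)"

text \<open>A drawing \<open>D\<close> maps each edge to its chain. The edge is unoriented, so either of its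
  vertices may be the first end.\<close>

definition respecting_embedding ::
    "'a set \<Rightarrow> 'a set set \<Rightarrow> ('a \<Rightarrow> int \<times> int) \<Rightarrow> ('a set \<Rightarrow> (int \<times> int) list) \<Rightarrow> bool" where
  "respecting_embedding V E \<mu> D \<longleftrightarrow>
     (\<forall>e\<in>E. simple_chain (D e) \<and> {hd (D e), last (D e)} = \<mu> ` e) \<and>
     (\<forall>e\<in>E. \<forall>v\<in>V - e. real_pt (\<mu> v) \<notin> chain (D e)) \<and>
     (\<forall>e\<in>E. \<forall>f\<in>E. e \<noteq> f \<longrightarrow> \<not> overlap (chain (D e)) (chain (D f)))"

text \<open>The angle in \<open>[0, \<pi>/2]\<close> between two lines with the given directions.\<close>

definition line_angle :: "real \<times> real \<Rightarrow> real \<times> real \<Rightarrow> real" where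
  "line_angle u v = arccos (\<bar>u \<bullet> v\<bar> / (norm u * norm v))"

text \<open>Any common point of two edges other than a common end vertex counts as a crossing; if it
  is a bend, all segments that contain it are subject to the angle condition.\<close>

definition aac_embedding ::
    "real \<Rightarrow> nat \<Rightarrow> 'a set \<Rightarrow> 'a set set \<Rightarrow> ('a \<Rightarrow> int \<times> int) \<Rightarrow>
     ('a set \<Rightarrow> (int \<times> int) list) \<Rightarrow> bool" where
  "aac_embedding \<alpha> b V E \<mu> D \<longleftrightarrow>
     respecting_embedding V E \<mu> D \<and>
     (\<forall>e\<in>E. num_bends (D e) \<le> b) \<and>
     (\<forall>e\<in>E. \<forall>f\<in>E. e \<noteq> f \<longrightarrow>
        (\<forall>i<num_segs (D e). \<forall>j<num_segs (D f).
           \<forall>p \<in> (chain_seg (D e) i \<inter> chain_seg (D f) j) - real_pt ` \<mu> ` (e \<inter> f).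
             \<alpha> \<le> line_angle (chain_dir (D e) i) (chain_dir (D f) j)))"

definition drawing_points ::
    "'a set \<Rightarrow> 'a set set \<Rightarrow> ('a \<Rightarrow> int \<times> int) \<Rightarrow> ('a set \<Rightarrow> (int \<times> int) list) \<Rightarrow>
     (real \<times> real) set" where
  "drawing_points V E \<mu> D = real_pt ` \<mu> ` V \<union> (\<Union>e\<in>E. chain (D e))"

definition bounding_box_area :: "(real \<times> real) set \<Rightarrow> real" where
  "bounding_box_area X =
     (if X = {} then 0 else (Sup (fst ` X) - Inf (fst ` X)) * (Sup (snd ` X) - Inf (snd ` X)))"

definition drawing_area ::
    "'a set \<Rightarrow> 'a set set \<Rightarrow> ('a \<Rightarrow> int \<times> int) \<Rightarrow> ('a set \<Rightarrow> (int \<times> int) list) \<Rightarrow> real" where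
  "drawing_area V E \<mu> D = bounding_box_area (drawing_points V E \<mu> D)"

text \<open>Every drawing contains all of \<open>S\<close>, which meets every row and column of the \<open>n \<times> n\<close>
  grid. So an area bound \<open>C n (m + cot \<epsilon>)\<close> can only hold for \<open>n\<close> at most linear in
  \<open>m + cot \<epsilon>\<close>.\<close>

lemma grid_coord_surj:
  fixes S :: "(int \<times> int) set"
  assumes "grid_point_set n S"
  shows "fst ` S = {1..int n}" "snd ` S = {1..int n}"
proof -
  have sub: "fst ` S \<subseteq> {1..int n}" "snd ` S \<subseteq> {1..int n}" and c: "card S = n"
    using assms unfolding grid_point_set_def by force+
  have i: "inj_on fst S" "inj_on snd S"
    using assms unfolding grid_point_set_def inj_on_def by metis+
  show "fst ` S = {1..int n}" "snd ` S = {1..int n}"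
    using card_subset_eq[OF _ sub(1)] card_subset_eq[OF _ sub(2)]
      card_image[OF i(1)] card_image[OF i(2)] c by auto
qed

lemma drawing_area_ge:
  assumes G: "simple_graph V E" and mu: "bij_betw \<mu> V S"
    and S: "grid_point_set n S" and n: "n > 0"
  shows "(real n - 1)\<^sup>2 \<le> drawing_area V E \<mu> D"
proof -
  let ?X = "drawing_points V E \<mu> D"
  have V: "finite V" and "E \<subseteq> Pow V" using G by (auto simp: simple_graph_def)
  then have E: "finite E" by (meson finite_Pow_iff finite_subset)
  have muV: "\<mu> ` V = S" using mu by (simp add: bij_betw_def)
  have "compact ?X" unfolding drawing_points_def chain_def chain_seg_def
    using V E
    by (intro compact_Un[OF finite_imp_compact compact_UN] compact_UN compact_segment ballI) auto
  then have bd: "bounded ?X" by (rule compact_imp_bounded)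
  have key: "real n - 1 \<le> Sup (g ` ?X) - Inf (g ` ?X)"
    if h: "h ` S = {1..int n}" "\<And>p. g (real_pt p) = real_of_int (h p)" and "bounded (g ` ?X)"
    for g h
  proof -
    have "1 \<in> h ` S" "int n \<in> h ` S" using h(1) n by auto
    then obtain p q where "p \<in> S" "h p = 1" "q \<in> S" "h q = int n" by (metis imageE)
    then have "g (real_pt p) = 1" "g (real_pt q) = n" "real_pt p \<in> ?X" "real_pt q \<in> ?X"
      using muV h(2) by (auto simp: drawing_points_def)
    then have "1 \<in> g ` ?X" "real n \<in> g ` ?X" by (metis image_eqI)+
    then have "real n \<le> Sup (g ` ?X)" "Inf (g ` ?X) \<le> 1"
      using that(3) by (auto intro: cSup_upper cInf_lower bounded_imp_bdd_above bounded_imp_bdd_below)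
    then show ?thesis by linarith
  qed
  have "real n - 1 \<le> Sup (fst ` ?X) - Inf (fst ` ?X)"
    by (rule key[OF grid_coord_surj(1)[OF S]]) (auto simp: real_pt_def bd bounded_fst)
  moreover have "real n - 1 \<le> Sup (snd ` ?X) - Inf (snd ` ?X)"
    by (rule key[OF grid_coord_surj(2)[OF S]]) (auto simp: real_pt_def bd bounded_snd)
  moreover have "?X \<noteq> {}"
    using grid_coord_surj(1)[OF S] n muV by (auto simp: drawing_points_def)
  ultimately show ?thesis
    unfolding drawing_area_def bounding_box_area_def power2_eq_square
    using n by (auto intro!: mult_mono)
qed

end

theory Submission
  imports Defs
begin

text \<open>Every edge \<open>e\<close> gets its own column \<open>c\<close>, to the right of the grid by at least \<open>cot \<epsilon>\<close>, and
  is drawn as \<open>\<mu>(u), (c, y\<^sub>u + 1), (c, y\<^sub>v + 1), \<mu>(v)\<close>. The first and last segment rise by exactly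
  one unit away from the vertex, so segments at different vertices lie in strips that meet only in
  a row, where one of them ends to the right of the grid and the other one starts inside; segments
  at a common vertex have different slopes. Hence a crossing always involves a vertical segment
  and one of slope at most \<open>tan \<epsilon>\<close>. The height is at most \<open>n\<close> and the width at most
  \<open>n + m + cot \<epsilon> - 1\<close>.\<close>

section \<open>Strands and bars, the pieces of an edge\<close>

text \<open>Both sloped ends of an edge are strands, directed away from the vertex; the last segment
  of a detour is one traversed backwards. One set of facts thus serves both ends.\<close>

definition strand :: "int \<Rightarrow> int \<times> int \<Rightarrow> (real \<times> real) set" where
  "strand c p = closed_segment (real_pt p) (real_pt (c, snd p + 1))"

definition bar :: "int \<Rightarrow> int \<Rightarrow> int \<Rightarrow> (real \<times> real) set" where
  "bar c a b = closed_segment (real_pt (c, a)) (real_pt (c, b))"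

definition detour :: "int \<Rightarrow> int \<times> int \<Rightarrow> int \<times> int \<Rightarrow> (int \<times> int) list" where
  "detour c p q = [p, (c, snd p + 1), (c, snd q + 1), q]"

text \<open>As a strand rises by exactly one, the height above \<open>p\<close> is itself the
  parameter of the segment, so \<open>fst z\<close> is affine in \<open>snd z\<close>.\<close>

lemma strandD:
  assumes "z \<in> strand c p"
  shows "real_of_int (snd p) \<le> snd z" "snd z \<le> real_of_int (snd p) + 1"
    "fst z = real_of_int (fst p) + (snd z - real_of_int (snd p)) * (real_of_int c - real_of_int (fst p))"
proof -
  obtain t where "0 \<le> t" "t \<le> 1"
    "z = (1 - t) *\<^sub>R real_pt p + t *\<^sub>R real_pt (c, snd p + 1)"
    using assms unfolding strand_def closed_segment_def by auto
  then show "real_of_int (snd p) \<le> snd z" "snd z \<le> real_of_int (snd p) + 1"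
    "fst z = real_of_int (fst p) + (snd z - real_of_int (snd p)) * (real_of_int c - real_of_int (fst p))"
    by (auto simp: real_pt_def algebra_simps)
qed

lemma strand_fst_bounds:
  assumes "z \<in> strand c p" "fst p < c"
  shows "real_of_int (fst p) \<le> fst z" "fst z \<le> real_of_int c"
proof -
  have "0 \<le> (snd z - real_of_int (snd p)) * (real_of_int c - real_of_int (fst p))"
    using strandD[OF assms(1)] assms(2) by simp
  moreover have "(snd z - real_of_int (snd p)) * (real_of_int c - real_of_int (fst p))
      \<le> 1 * (real_of_int c - real_of_int (fst p))"
    using strandD[OF assms(1)] assms(2) by (intro mult_right_mono) auto
  ultimately show "real_of_int (fst p) \<le> fst z" "fst z \<le> real_of_int c"
    using strandD(3)[OF assms(1)] by auto
qed

lemma barD: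
  assumes "z \<in> bar c a b"
  shows "fst z = real_of_int c" "real_of_int (min a b) \<le> snd z" "snd z \<le> real_of_int (max a b)"
proof -
  obtain t where t: "0 \<le> t" "t \<le> 1"
    and z: "z = (1 - t) *\<^sub>R real_pt (c, a) + t *\<^sub>R real_pt (c, b)"
    using assms unfolding bar_def closed_segment_def by auto
  show "fst z = real_of_int c"
    by (simp add: z real_pt_def algebra_simps)
  have "snd z = (1 - t) *\<^sub>R real_of_int a + t *\<^sub>R real_of_int b"
    by (simp add: z real_pt_def)
  then have "snd z \<in> closed_segment (real_of_int a) (real_of_int b)"
    using t by (auto simp: closed_segment_def)
  then show "real_of_int (min a b) \<le> snd z" "snd z \<le> real_of_int (max a b)"
    by (auto simp: closed_segment_eq_real_ivl split: if_splits)
qed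

lemma strand_start: "real_pt p \<in> strand c p"
  and strand_end: "real_pt (c, snd p + 1) \<in> strand c p"
  by (auto simp: strand_def)

lemma bar_ends: "real_pt (c, a) \<in> bar c a b" "real_pt (c, b) \<in> bar c a b"
  by (auto simp: bar_def)

lemma strands_disjoint:
  assumes "snd p \<noteq> snd q" "fst p < c" "fst q < c" "fst p < d" "fst q < d"
  shows "strand c p \<inter> strand d q = {}"
proof -
  \<comment> \<open>The lower strand is that of \<open>p'\<close>. Only its column has to lie right
    of the upper vertex, so both orders of \<open>p\<close> and \<open>q\<close> are
    instances.\<close>
  have *: False if lt: "snd p' < snd q'" and less: "fst q' < c'"
    and z: "z \<in> strand c' p'" "z \<in> strand d' q'" for p' q' :: "int \<times> int" and c' d' z
  proof -
    have "real_of_int (snd p') + 1 \<le> real_of_int (snd q')" using lt by linarith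
    then have "snd z = real_of_int (snd p') + 1" "snd z = real_of_int (snd q')"
      using strandD(2)[OF z(1)] strandD(1)[OF z(2)] by linarith+
    then have "fst z = real_of_int c'" "fst z = real_of_int (fst q')"
      using strandD(3)[OF z(1)] strandD(3)[OF z(2)] by auto
    then show False using less by simp
  qed
  show ?thesis
    using *[of p q c _ d] *[of q p d _ c] assms by (cases "snd p < snd q") auto
qed

text \<open>At height \<open>h\<close> above \<open>p\<close> the abscissas of the two strands
  differ by \<open>h * (c - d)\<close>, which vanishes only for \<open>h = 0\<close>.\<close>

lemma strands_common_start:
  assumes "c \<noteq> d"
  shows "strand c p \<inter> strand d p = {real_pt p}"
proof -
  have "z = real_pt p" if z: "z \<in> strand c p" "z \<in> strand d p" for z
  proof -
    have "(snd z - real_of_int (snd p)) * (real_of_int c - real_of_int d) = 0"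
      using strandD(3)[OF z(1)] strandD(3)[OF z(2)] by (simp add: algebra_simps)
    then have "snd z = real_of_int (snd p)" using assms by simp
    then show ?thesis using strandD(3)[OF z(1)] by (simp add: real_pt_def prod_eq_iff)
  qed
  then show ?thesis using strand_start[of p] by blast
qed

text \<open>The abscissa grows strictly along a strand, its horizontal run \<open>c - fst p\<close>
  being positive.\<close>

lemma strand_column_unique:
  assumes "fst p < c" "z \<in> strand c p" "w \<in> strand c p" "fst z = fst w"
  shows "z = w"
proof -
  have "(snd z - snd w) * (real_of_int c - real_of_int (fst p)) = 0"
    using strandD(3)[OF assms(2)] strandD(3)[OF assms(3)] assms(4) by (simp add: algebra_simps)
  then show ?thesis using assms(1,4) by (simp add: prod_eq_iff)
qed

text \<open>A bar has a single abscissa, so there is at most one common point. Finiteness is the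
  form in which overlaps are excluded later.\<close>

lemma strand_inter_bar_finite:
  assumes "fst p < c"
  shows "finite (strand c p \<inter> bar d a b)"
proof (cases "strand c p \<inter> bar d a b = {}")
  case False
  then obtain w where w: "w \<in> strand c p" "w \<in> bar d a b" by blast
  then have "z = w" if "z \<in> strand c p \<inter> bar d a b" for z
    using strand_column_unique[OF assms, of z w] barD(1)[of z d a b] barD(1)[OF w(2)] that by simp
  then have "strand c p \<inter> bar d a b \<subseteq> {w}" by blast
  then show ?thesis by (rule finite_subset) simp
qed simp

text \<open>A strand reaches its own column only at its end, which is the bend.\<close>

lemma strand_inter_own_bar:
  assumes "fst p < c" "snd p + 1 \<in> {a, b}"
  shows "strand c p \<inter> bar c a b = {real_pt (c, snd p + 1)}"
proof -
  have "real_pt (c, snd p + 1) \<in> bar c a b"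
    using assms(2) bar_ends by auto
  moreover have "z = real_pt (c, snd p + 1)" if "z \<in> strand c p" "z \<in> bar c a b" for z
    using strand_column_unique[OF assms(1) that(1) strand_end] barD(1)[OF that(2)]
    by (simp add: real_pt_def)
  ultimately show ?thesis using strand_end[of c p] by blast
qed

lemma bars_disjoint: "c \<noteq> d \<Longrightarrow> bar c a b \<inter> bar d a' b' = {}"
  by (auto dest!: barD(1))

section \<open>Detours as three-segment chains\<close>

lemma num_segs_detour [simp]: "num_segs (detour c p q) = 3"
  by (simp add: num_segs_def detour_def)

lemma chain_seg_detour [simp]:
  "chain_seg (detour c p q) 0 = strand c p"
  "chain_seg (detour c p q) (Suc 0) = bar c (snd p + 1) (snd q + 1)"
  "chain_seg (detour c p q) 2 = strand c q"
  by (simp_all add: chain_seg_def detour_def strand_def bar_def numeral_2_eq_2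
      closed_segment_commute)

lemma chain_dir_detour [simp]:
  "chain_dir (detour c p q) 0 = (real_of_int (c - fst p), 1)"
  "chain_dir (detour c p q) (Suc 0) = (0, real_of_int (snd q - snd p))"
  "chain_dir (detour c p q) 2 = (- real_of_int (c - fst q), - 1)"
  by (simp_all add: chain_dir_def detour_def numeral_2_eq_2 real_pt_def)

lemma nth_detour [simp]:
  "detour c p q ! Suc 0 = (c, snd p + 1)" "detour c p q ! 2 = (c, snd q + 1)"
  by (simp_all add: detour_def)

lemma less_3_cases: "i < (3::nat) \<Longrightarrow> i = 0 \<or> i = Suc 0 \<or> i = 2"
  by auto

lemma chain_detour:
  "chain (detour c p q) = strand c p \<union> bar c (snd p + 1) (snd q + 1) \<union> strand c q"
proof -
  have "{..<3::nat} = {0, Suc 0, 2}" by auto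
  then show ?thesis by (auto simp: chain_def)
qed

text \<open>As the ends lie in different rows, the bar is nondegenerate and the two strands are
  disjoint; each strand meets the bar only in their common bend.\<close>

lemma simple_chain_detour:
  assumes "fst p < c" "fst q < c" "snd p \<noteq> snd q"
  shows "simple_chain (detour c p q)"
proof -
  have seg: "chain_seg (detour c p q) i \<inter> chain_seg (detour c p q) j =
      (if j = Suc i then {real_pt (detour c p q ! j)} else {})" if ij: "j < 3" "i < j" for i j
  proof -
    consider "i = 0" "j = Suc 0" | "i = 0" "j = 2" | "i = Suc 0" "j = 2"
      using ij less_3_cases[of j] by fastforce
    then show ?thesis
    proof cases
      case 1
      then show ?thesis using strand_inter_own_bar[of p c] assms by simp
    next
      case 2
      then show ?thesis using strands_disjoint[of p q c c] assms by simp
    next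
      case 3
      then show ?thesis using strand_inter_own_bar[of q c] assms
        by (simp add: Int_commute)
    qed
  qed
  have "detour c p q ! i \<noteq> detour c p q ! Suc i" if "i < 3" for i
    using less_3_cases[OF that] assms by (auto simp: detour_def numeral_2_eq_2 prod_eq_iff)
  then show ?thesis
    using seg by (simp add: simple_chain_def detour_def[of c p q, THEN arg_cong[where f = length]])
qed

section \<open>Angle between a strand and a vertical line\<close>

lemma line_angle_commute: "line_angle u v = line_angle v u"
  by (simp add: line_angle_def inner_commute mult.commute)

lemma line_angle_uminus: "line_angle (- u) v = line_angle u v"
  by (simp add: line_angle_def)

text \<open>The cosine of this angle is \<open>1 / sqrt (d\<^sup>2 + 1)\<close>. Since 1 plus the
  squared cotangent is the inverse squared sine, \<open>cot \<epsilon> \<le> d\<close> bounds it by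
  \<open>sin \<epsilon>\<close>, the cosine of \<open>pi / 2 - \<epsilon>\<close>.\<close>

lemma line_angle_vertical_ge:
  assumes "0 < \<epsilon>" "\<epsilon> < pi / 2" "cot \<epsilon> \<le> d" "h \<noteq> 0"
  shows "pi / 2 - \<epsilon> \<le> line_angle (d, 1) (0, h)"
proof -
  have d: "0 < sin \<epsilon>" "0 < cos \<epsilon>"
    using assms by (auto intro: sin_gt_zero cos_gt_zero)
  then have "0 < cot \<epsilon>" by (simp add: cot_def)
  then have "(cot \<epsilon>)\<^sup>2 \<le> d\<^sup>2" using assms(3) by (intro power_mono) auto
  moreover have "1 + (cot \<epsilon>)\<^sup>2 = 1 / (sin \<epsilon>)\<^sup>2"
    using d sin_cos_squared_add[of \<epsilon>] by (simp add: cot_def field_simps)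
  ultimately have "1 / sin \<epsilon> \<le> sqrt (d\<^sup>2 + 1)"
    using d by (intro real_le_rsqrt) (auto simp: power_divide)
  moreover have "0 < sqrt (d\<^sup>2 + 1)" by (simp add: add_nonneg_pos)
  ultimately have "1 / sqrt (d\<^sup>2 + 1) \<le> sin \<epsilon>" using d by (simp add: field_simps)
  moreover have "\<bar>(d, 1) \<bullet> (0, h)\<bar> / (norm (d, 1::real) * norm (0::real, h)) = 1 / sqrt (d\<^sup>2 + 1)"
    using assms(4) by (simp add: norm_Pair)
  ultimately have "arccos (sin \<epsilon>) \<le> line_angle (d, 1) (0, h)"
    unfolding line_angle_def using \<open>0 < sqrt (d\<^sup>2 + 1)\<close> sin_le_one[of \<epsilon>]
    by (intro arccos_le_arccos) (auto intro: order_trans[of _ 0])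
  moreover have "arccos (sin \<epsilon>) = pi / 2 - \<epsilon>"
    using arccos_cos[of "pi / 2 - \<epsilon>"] assms by (simp add: cos_sin_eq)
  ultimately show ?thesis by simp
qed

section \<open>How detours meet each other and foreign vertices\<close>

text \<open>An overlap contains a nondegenerate segment, which is uncountable.\<close>

lemma finite_inter_not_overlap:
  assumes "finite (X \<inter> Y)"
  shows "\<not> overlap X Y"
  unfolding overlap_def
  using assms uncountable_closed_segment by (meson countable_finite finite_subset)

text \<open>Injectivity of \<open>snd\<close> on the set of ends keeps distinct ends in distinct
  rows and still lets the two edges share an end.\<close>

lemma detours_crossing_angle:
  assumes col: "c \<noteq> d"
    and len: "\<forall>x\<in>{p, q, p', q'}. cot \<epsilon> \<le> real_of_int (c - fst x) \<and> cot \<epsilon> \<le> real_of_int (d - fst x)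
               \<and> fst x < c \<and> fst x < d"
    and row: "snd p \<noteq> snd q" "snd p' \<noteq> snd q'"
    and inj: "inj_on snd {p, q, p', q'}"
    and eps: "0 < \<epsilon>" "\<epsilon> < pi / 2"
    and ij: "i < 3" "j < 3"
    and z: "z \<in> chain_seg (detour c p q) i" "z \<in> chain_seg (detour d p' q') j"
      "z \<notin> real_pt ` ({p, q} \<inter> {p', q'})"
  shows "pi / 2 - \<epsilon> \<le> line_angle (chain_dir (detour c p q) i) (chain_dir (detour d p' q') j)"
proof -
  \<comment> \<open>Four variants: the strand may be the rising first or the falling last segment of
    its edge, and it may belong to either edge.\<close>
  have steep: "pi / 2 - \<epsilon> \<le> line_angle (real_of_int (k - fst x), 1) (0, real_of_int h)"
    "pi / 2 - \<epsilon> \<le> line_angle (- real_of_int (k - fst x), - 1) (0, real_of_int h)"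
    "pi / 2 - \<epsilon> \<le> line_angle (0, real_of_int h) (real_of_int (k - fst x), 1)"
    "pi / 2 - \<epsilon> \<le> line_angle (0, real_of_int h) (- real_of_int (k - fst x), - 1)"
    if "x \<in> {p, q, p', q'}" "k \<in> {c, d}" "h \<noteq> 0" for x :: "int \<times> int" and k h
  proof -
    have "cot \<epsilon> \<le> real_of_int (k - fst x)" using len that by auto
    from line_angle_vertical_ge[OF eps this, of "real_of_int h"] that
    have *: "pi / 2 - \<epsilon> \<le> line_angle (real_of_int (k - fst x), 1) (0, real_of_int h)" by simp
    then show "pi / 2 - \<epsilon> \<le> line_angle (real_of_int (k - fst x), 1) (0, real_of_int h)"
      "pi / 2 - \<epsilon> \<le> line_angle (- real_of_int (k - fst x), - 1) (0, real_of_int h)"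
      "pi / 2 - \<epsilon> \<le> line_angle (0, real_of_int h) (real_of_int (k - fst x), 1)"
      "pi / 2 - \<epsilon> \<le> line_angle (0, real_of_int h) (- real_of_int (k - fst x), - 1)"
      using line_angle_uminus[of "(real_of_int (k - fst x), 1)" "(0, real_of_int h)"]
      by (simp_all add: line_angle_commute[of "(0, _)"])
  qed
  \<comment> \<open>Here the exclusion of common end vertices enters: two strands at the same vertex
    meet nowhere else.\<close>
  have no: False if "x \<in> {p, q}" "y \<in> {p', q'}" "z \<in> strand c x" "z \<in> strand d y" for x y
  proof (cases "x = y")
    case True
    then have "z = real_pt x" using strands_common_start[OF col, of x] that by auto
    then show False using z(3) that True by blast
  next
    case False
    then have "snd x \<noteq> snd y" using inj that by (auto simp: inj_on_def)
    then show False using strands_disjoint[of x y c d] len that by blast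
  qed
  consider "i \<in> {0, 2}" "j \<in> {0, 2}" | "i \<in> {0, 2}" "j = Suc 0" | "i = Suc 0" "j \<in> {0, 2}"
    | "i = Suc 0" "j = Suc 0"
    using less_3_cases[OF ij(1)] less_3_cases[OF ij(2)] by blast
  then show ?thesis
  proof cases
    case 1
    then have "z \<in> strand c p \<or> z \<in> strand c q" "z \<in> strand d p' \<or> z \<in> strand d q'"
      using z by auto
    then show ?thesis using no by blast
  next
    case 2
    then show ?thesis
      using steep(1)[of p c "snd q' - snd p'"] steep(2)[of q c "snd q' - snd p'"] row by auto
  next
    case 3
    then show ?thesis
      using steep(3)[of p' d "snd q - snd p"] steep(4)[of q' d "snd q - snd p"] row by auto
  next
    case 4
    then show ?thesis
      using bars_disjoint[OF col, of "snd p + 1" "snd q + 1" "snd p' + 1" "snd q' + 1"] z by auto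
  qed
qed

text \<open>Of the nine pairs of pieces, the bars are disjoint and every other pair shares at most
  one point, so the chains have finite intersection.\<close>

lemma detours_not_overlap:
  assumes col: "c \<noteq> d"
    and right: "\<forall>x\<in>{p, q, p', q'}. fst x < c \<and> fst x < d"
    and inj: "inj_on snd {p, q, p', q'}"
  shows "\<not> overlap (chain (detour c p q)) (chain (detour d p' q'))"
proof (rule finite_inter_not_overlap)
  have ss: "finite (strand c x \<inter> strand d y)" if "x \<in> {p, q}" "y \<in> {p', q'}" for x y
  proof (cases "x = y")
    case True
    then show ?thesis using strands_common_start[OF col, of x] by simp
  next
    case False
    then have "snd x \<noteq> snd y" using inj that by (auto simp: inj_on_def)
    moreover have "fst x < c" "fst x < d" "fst y < c" "fst y < d" using right that by auto
    ultimately show ?thesis using strands_disjoint[of x y c d] by simp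
  qed
  have sb: "finite (strand c x \<inter> bar d a b)" if "x \<in> {p, q}" for x a b
    using right that by (intro strand_inter_bar_finite) auto
  have bs: "finite (bar c a b \<inter> strand d y)" if "y \<in> {p', q'}" for y a b
    using right that by (subst Int_commute, intro strand_inter_bar_finite) auto
  show "finite (chain (detour c p q) \<inter> chain (detour d p' q'))"
    unfolding chain_detour Int_Un_distrib Int_Un_distrib2 bars_disjoint[OF col] finite_Un
    by (intro conjI ss sb bs finite.emptyI insertI1 insertI2)
qed

lemma detour_avoids_point:
  assumes "fst v < c" "fst p < c" "fst q < c" "snd v \<noteq> snd p" "snd v \<noteq> snd q"
  shows "real_pt v \<notin> chain (detour c p q)"
proof -
  \<comment> \<open>The point \<open>v\<close> starts a fictitious strand of its own to column
    \<open>c\<close>, so the disjointness of strands applies to it.\<close>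
  have "real_pt v \<notin> strand c x" if "snd v \<noteq> snd x" "fst x < c" for x
    using strands_disjoint[of v x c c] strand_start[of v c] that assms(1) by blast
  moreover have "real_pt v \<notin> bar c a b" for a b
    using barD(1)[of "real_pt v" c a b] assms(1) by (fastforce simp: real_pt_def)
  ultimately show ?thesis using assms by (simp add: chain_detour)
qed

section \<open>Bounding box\<close>

text \<open>A vertex in row \<open>N\<close> has its bend in row \<open>N + 1\<close>; the rows from
  1 to \<open>N + 1\<close> span a height of only \<open>N\<close>.\<close>

lemma chain_detour_bounds:
  assumes "z \<in> chain (detour c p q)" "fst p < c" "fst q < c"
    "p \<in> {1..N} \<times> {1..N}" "q \<in> {1..N} \<times> {1..N}"
  shows "z \<in> {1..real_of_int c} \<times> {1..real_of_int N + 1}"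
proof -
  have strand: "w \<in> {1..real_of_int c} \<times> {1..real_of_int N + 1}"
    if w: "w \<in> strand c x" and x: "fst x < c" "x \<in> {1..N} \<times> {1..N}" for w x
  proof -
    have "1 \<le> real_of_int (fst x)" "1 \<le> real_of_int (snd x)" "real_of_int (snd x) \<le> real_of_int N"
      using x(2) by (auto simp: mem_Times_iff)
    then show ?thesis
      using strandD(1,2)[OF w] strand_fst_bounds[OF w x(1)] unfolding mem_Times_iff by auto
  qed
  have "z \<in> {1..real_of_int c} \<times> {1..real_of_int N + 1}"
    if w: "z \<in> bar c (snd p + 1) (snd q + 1)"
  proof -
    have "1 \<le> min (snd p + 1) (snd q + 1)" "max (snd p + 1) (snd q + 1) \<le> N + 1" "1 \<le> c"
      using assms(2-) by (auto simp: mem_Times_iff)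
    then have "1 \<le> real_of_int (min (snd p + 1) (snd q + 1))"
      "real_of_int (max (snd p + 1) (snd q + 1)) \<le> real_of_int (N + 1)" "1 \<le> real_of_int c"
      by linarith+
    then show ?thesis using barD[OF w] unfolding mem_Times_iff by auto
  qed
  then show ?thesis using strand assms unfolding chain_detour by blast
qed

lemma bounding_box_area_le:
  assumes "X \<subseteq> {a..b} \<times> {c..d}" "a \<le> b" "c \<le> d"
  shows "bounding_box_area X \<le> (b - a) * (d - c)"
proof (cases "X = {}")
  case False
  have "fst ` X \<subseteq> {a..b}" "snd ` X \<subseteq> {c..d}" using assms(1) by auto
  then have bnds: "Sup (fst ` X) \<le> b" "a \<le> Inf (fst ` X)" "Sup (snd ` X) \<le> d" "c \<le> Inf (snd ` X)"
    using False by (auto intro!: cSup_least cInf_greatest)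
  \<comment> \<open>Monotonicity of the product requires the actual height to be
    nonnegative.\<close>
  have "bdd_above (snd ` X)" "bdd_below (snd ` X)"
    using \<open>snd ` X \<subseteq> {c..d}\<close> bdd_above_mono[of "{c..d}"] bdd_below_mono[of "{c..d}"] by auto
  then have "Inf (snd ` X) \<le> Sup (snd ` X)"
    using False by (intro cInf_le_cSup) auto
  then show ?thesis
    using bnds False assms unfolding bounding_box_area_def by (auto intro!: mult_mono)
qed (use assms in \<open>simp add: bounding_box_area_def\<close>)

section \<open>The drawing of the whole graph\<close>

lemma simple_graph_endpoints:
  assumes "simple_graph V E"
  obtains s t where "\<And>e. e \<in> E \<Longrightarrow> e = {s e, t e}" "\<And>e. e \<in> E \<Longrightarrow> s e \<noteq> t e"
proof -
  have "\<forall>e\<in>E. \<exists>u v. e = {u, v} \<and> u \<noteq> v"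
    using assms by (simp add: simple_graph_def card_2_iff)
  then show thesis using that by metis
qed

lemma detour_embedding_exists:
  fixes \<mu> :: "'a \<Rightarrow> int \<times> int"
  assumes G: "simple_graph V E" and S: "grid_point_set n S" and mu: "bij_betw \<mu> V S"
    and eps: "0 < \<epsilon>" "\<epsilon> < pi / 2"
  obtains D where "aac_embedding (pi / 2 - \<epsilon>) 2 V E \<mu> D"
    "drawing_points V E \<mu> D \<subseteq> {1..real n + real (card E) + cot \<epsilon>} \<times> {1..real n + 1}"
proof -
  have "0 < sin \<epsilon>" "0 < cos \<epsilon>" using eps by (auto intro: sin_gt_zero cos_gt_zero)
  then have cot: "0 < cot \<epsilon>" by (simp add: cot_def)
  have "finite E" using G unfolding simple_graph_def by (meson Pow_iff finite_Pow_iff finite_subset subsetI)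
  then obtain r where r: "bij_betw r E {0..<card E}" using ex_bij_betw_finite_nat by blast
  obtain s t where st: "\<And>e. e \<in> E \<Longrightarrow> e = {s e, t e}" and neq: "\<And>e. e \<in> E \<Longrightarrow> s e \<noteq> t e"
    using simple_graph_endpoints[OF G] by blast
  have in_e: "s e \<in> e" "t e \<in> e" if "e \<in> E" for e
    using st[OF that] by (metis insertI1, metis insertI1 insertI2)
  have edge: "e \<subseteq> V" if "e \<in> E" for e
    using G that by (simp add: simple_graph_def)
  have in_V: "s e \<in> V" "t e \<in> V" if "e \<in> E" for e
    using in_e[OF that] edge[OF that] by auto
  \<comment> \<open>Vertices have abscissa at most \<open>n\<close>, so even the edge numbered 0
    gets horizontal runs of at least \<open>cot \<epsilon>\<close>; the number \<open>r e\<close>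
    separates the columns.\<close>
  define col where "col e = int n + \<lceil>cot \<epsilon>\<rceil> + int (r e)" for e
  define D where "D e = detour (col e) (\<mu> (s e)) (\<mu> (t e))" for e
  have col_inj: "col e \<noteq> col f" if "e \<in> E" "f \<in> E" "e \<noteq> f" for e f
    using bij_betw_imp_inj_on[OF r] that by (auto simp: col_def inj_on_def)
  have mu_in: "\<mu> v \<in> {1..int n} \<times> {1..int n}" if "v \<in> V" for v
    using S bij_betwE[OF mu] that unfolding grid_point_set_def by blast
  have row: "snd (\<mu> v) \<noteq> snd (\<mu> w)" if "v \<in> V" "w \<in> V" "v \<noteq> w" for v w
    using S bij_betwE[OF mu] bij_betw_imp_inj_on[OF mu] that
    unfolding grid_point_set_def inj_on_def by metis
  have cot_le: "cot \<epsilon> \<le> real_of_int (col e - fst (\<mu> v))" if "v \<in> V" for e v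
  proof -
    have "fst (\<mu> v) \<le> int n" using mu_in[OF that] by (simp add: mem_Times_iff)
    then have "\<lceil>cot \<epsilon>\<rceil> \<le> col e - fst (\<mu> v)" by (simp add: col_def)
    then show ?thesis by (simp add: ceiling_le_iff)
  qed
  have right: "fst (\<mu> v) < col e" if "v \<in> V" for e v
    using cot_le[OF that, of e] cot by linarith
  have inj_rows: "inj_on snd (\<mu> ` U)" if "U \<subseteq> V" for U
    using row that by (fastforce simp: inj_on_def)
  have sub: "{\<mu> (s e), \<mu> (t e), \<mu> (s f), \<mu> (t f)} = \<mu> ` {s e, t e, s f, t f}" for e f
    by simp
  have image_e: "\<mu> ` e = {\<mu> (s e), \<mu> (t e)}" if "e \<in> E" for e
    using arg_cong[OF st[OF that], of "image \<mu>"] by simp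
  \<comment> \<open>The angle condition excludes images of common vertices, the crossing lemma
    common end points; injectivity of \<open>\<mu>\<close> identifies the two.\<close>
  have common: "\<mu> ` (e \<inter> f) = {\<mu> (s e), \<mu> (t e)} \<inter> {\<mu> (s f), \<mu> (t f)}" if "e \<in> E" "f \<in> E" for e f
  proof -
    have "inj_on \<mu> (e \<union> f)"
      using edge that by (intro inj_on_subset[OF bij_betw_imp_inj_on[OF mu]]) blast
    then have "\<mu> ` (e \<inter> f) = \<mu> ` e \<inter> \<mu> ` f" by (intro inj_on_image_Int) auto
    then show ?thesis using image_e that by simp
  qed
  have "simple_chain (D e) \<and> {hd (D e), last (D e)} = \<mu> ` e" if "e \<in> E" for e
    using simple_chain_detour[of "\<mu> (s e)" "col e" "\<mu> (t e)"] right row in_V[OF that] neq[OF that]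
      image_e[OF that] by (simp add: D_def) (simp add: detour_def)
  moreover have "real_pt (\<mu> v) \<notin> chain (D e)" if "e \<in> E" "v \<in> V - e" for e v
    unfolding D_def using right row in_V[OF that(1)] in_e[OF that(1)] that
    by (intro detour_avoids_point) blast+
  moreover have "\<not> overlap (chain (D e)) (chain (D f))" if "e \<in> E" "f \<in> E" "e \<noteq> f" for e f
    unfolding D_def
  proof (rule detours_not_overlap[OF col_inj[OF that]])
    show "inj_on snd {\<mu> (s e), \<mu> (t e), \<mu> (s f), \<mu> (t f)}"
      unfolding sub using in_V that by (intro inj_rows) blast
  qed (use right in_V that in blast)
  ultimately have "respecting_embedding V E \<mu> D" unfolding respecting_embedding_def by blast
  moreover have "num_bends (D e) \<le> 2" for e by (simp add: num_bends_def D_def detour_def)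
  moreover have "pi / 2 - \<epsilon> \<le> line_angle (chain_dir (D e) i) (chain_dir (D f) j)"
    if ef: "e \<in> E" "f \<in> E" "e \<noteq> f" and ij: "i < num_segs (D e)" "j < num_segs (D f)"
      and z: "z \<in> (chain_seg (D e) i \<inter> chain_seg (D f) j) - real_pt ` \<mu> ` (e \<inter> f)" for e f i j z
    unfolding D_def
  proof (rule detours_crossing_angle[OF col_inj[OF ef], where z = z])
    show "inj_on snd {\<mu> (s e), \<mu> (t e), \<mu> (s f), \<mu> (t f)}"
      unfolding sub using in_V ef by (intro inj_rows) blast
    show "\<forall>x\<in>{\<mu> (s e), \<mu> (t e), \<mu> (s f), \<mu> (t f)}. cot \<epsilon> \<le> real_of_int (col e - fst x)
        \<and> cot \<epsilon> \<le> real_of_int (col f - fst x) \<and> fst x < col e \<and> fst x < col f"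
      using right cot_le in_V ef by blast
    show "snd (\<mu> (s e)) \<noteq> snd (\<mu> (t e))" "snd (\<mu> (s f)) \<noteq> snd (\<mu> (t f))"
      using row in_V neq ef by blast+
  qed (use z ij common[OF ef(1,2)] eps in \<open>auto simp: D_def\<close>)
  ultimately have "aac_embedding (pi / 2 - \<epsilon>) 2 V E \<mu> D" unfolding aac_embedding_def by blast
  moreover have "drawing_points V E \<mu> D \<subseteq> {1..real n + real (card E) + cot \<epsilon>} \<times> {1..real n + 1}"
  proof -
    have "real_pt (\<mu> v) \<in> {1..real n + real (card E) + cot \<epsilon>} \<times> {1..real n + 1}" if "v \<in> V" for v
    proof -
      have "1 \<le> fst (\<mu> v)" "fst (\<mu> v) \<le> int n" "1 \<le> snd (\<mu> v)" "snd (\<mu> v) \<le> int n"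
        using mu_in[OF that] by (auto simp: mem_Times_iff)
      then have "1 \<le> real_of_int (fst (\<mu> v))" "real_of_int (fst (\<mu> v)) \<le> n"
        "1 \<le> real_of_int (snd (\<mu> v))" "real_of_int (snd (\<mu> v)) \<le> n" by linarith+
      then show ?thesis using cot by (simp add: real_pt_def)
    qed
    moreover have "chain (D e) \<subseteq> {1..real n + real (card E) + cot \<epsilon>} \<times> {1..real n + 1}"
      if "e \<in> E" for e
    proof -
      \<comment> \<open>Rounding \<open>cot \<epsilon>\<close> up costs less than one, which is made
        up for by numbering the edges from 0.\<close>
      have "r e < card E" using bij_betwE[OF r] that by auto
      then have "real_of_int (col e) \<le> real n + real (card E) + cot \<epsilon>"
        unfolding col_def by linarith
      moreover have "chain (D e) \<subseteq> {1..real_of_int (col e)} \<times> {1..real_of_int (int n) + 1}"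
        unfolding D_def using chain_detour_bounds mu_in right in_V[OF that] by blast
      ultimately show ?thesis by (fastforce simp: mem_Times_iff)
    qed
    ultimately show ?thesis unfolding drawing_points_def by blast
  qed
  ultimately show thesis using that by blast
qed

section \<open>Estimate of the area\<close>

text \<open>From \<open>\<epsilon> \<le> tan \<epsilon>\<close> the cotangent is at most
  \<open>1 / \<epsilon>\<close>, and \<open>\<epsilon> < pi / 2 < 2\<close> supplies the remaining
  factor \<open>2 / \<epsilon>\<close>.\<close>

lemma cot_le_2_divide_square:
  assumes "0 < \<epsilon>" "\<epsilon> < pi / 2"
  shows "cot \<epsilon> \<le> 2 / \<epsilon>\<^sup>2"
proof -
  have tan: "\<epsilon> \<le> tan \<epsilon>"
    using abs_tan_ge[of \<epsilon>] tan_gt_zero[OF assms] assms by simp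
  have "cot \<epsilon> = 1 / tan \<epsilon>" by (simp add: cot_def tan_def)
  also have "\<dots> \<le> 1 / \<epsilon>" using tan assms by (simp add: frac_le)
  also have "\<dots> \<le> 2 / \<epsilon>\<^sup>2"
    using assms pi_less_4 by (simp add: field_simps power2_eq_square)
  finally show ?thesis .
qed

theorem theorem7:
  "\<forall>K::real. \<exists>C>0. \<exists>C'>0. \<forall>(V :: 'a set) E S (n::nat) (m::nat) (\<epsilon>::real).
     simple_graph V E \<and> card V = n \<and> card E = m \<and> grid_point_set n S \<and>
     0 < \<epsilon> \<and> \<epsilon> < pi / 2 \<longrightarrow>
       (\<exists>\<mu>. bij_betw \<mu> V S) \<and>
       (\<forall>\<mu>. bij_betw \<mu> V S \<longrightarrow>
          (\<exists>D. aac_embedding (pi / 2 - \<epsilon>) 2 V E \<mu> D \<and>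
               (real n \<le> K * (real m + cot \<epsilon>) + 1 \<longrightarrow>
                  drawing_area V E \<mu> D \<le> C * (real n * (real m + cot \<epsilon>))))) \<and>
       C * (real n * (real m + cot \<epsilon>)) \<le> C' * (real n * (real m + 1 / \<epsilon>\<^sup>2))"
proof (intro allI)
  fix K :: real
  \<comment> \<open>The estimate yields the factor \<open>K + 1\<close>; the absolute value makes
    the constant positive for negative \<open>K\<close> too.\<close>
  define C where "C = \<bar>K\<bar> + 1"
  have C: "0 < C" "K + 1 \<le> C" by (auto simp: C_def)
  show "\<exists>C>0. \<exists>C'>0. \<forall>(V :: 'a set) E S (n::nat) (m::nat) (\<epsilon>::real).
     simple_graph V E \<and> card V = n \<and> card E = m \<and> grid_point_set n S \<and>
     0 < \<epsilon> \<and> \<epsilon> < pi / 2 \<longrightarrow>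
       (\<exists>\<mu>. bij_betw \<mu> V S) \<and>
       (\<forall>\<mu>. bij_betw \<mu> V S \<longrightarrow>
          (\<exists>D. aac_embedding (pi / 2 - \<epsilon>) 2 V E \<mu> D \<and>
               (real n \<le> K * (real m + cot \<epsilon>) + 1 \<longrightarrow>
                  drawing_area V E \<mu> D \<le> C * (real n * (real m + cot \<epsilon>))))) \<and>
       C * (real n * (real m + cot \<epsilon>)) \<le> C' * (real n * (real m + 1 / \<epsilon>\<^sup>2))"
  proof (rule exI[of _ C], intro conjI C exI[of _ "2 * C"] allI impI; (elim conjE)?)
    show "0 < 2 * C" using C by simp
  next
    fix V :: "'a set" and E S n m and \<epsilon> :: real
    assume G: "simple_graph V E" and nm: "card V = n" "card E = m" and S: "grid_point_set n S"
      and eps: "0 < \<epsilon>" "\<epsilon> < pi / 2"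
    have "0 < sin \<epsilon>" "0 < cos \<epsilon>" using eps by (auto intro: sin_gt_zero cos_gt_zero)
    then have cot: "0 < cot \<epsilon>" by (simp add: cot_def)
    have "finite S" using S finite_subset by (fastforce simp: grid_point_set_def)
    then show "\<exists>\<mu>. bij_betw \<mu> V S"
      using G nm S by (intro finite_same_card_bij) (auto simp: simple_graph_def grid_point_set_def)
    have "real m + cot \<epsilon> \<le> 2 * (real m + 1 / \<epsilon>\<^sup>2)"
      using cot_le_2_divide_square[OF eps] by simp
    then have "C * (real n * (real m + cot \<epsilon>)) \<le> C * (real n * (2 * (real m + 1 / \<epsilon>\<^sup>2)))"
      using C by (intro mult_left_mono) auto
    then show "C * (real n * (real m + cot \<epsilon>)) \<le> 2 * C * (real n * (real m + 1 / \<epsilon>\<^sup>2))"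
      by (simp add: mult_ac)
    fix \<mu> assume mu: "bij_betw \<mu> V S"
    obtain D where D: "aac_embedding (pi / 2 - \<epsilon>) 2 V E \<mu> D"
      "drawing_points V E \<mu> D \<subseteq> {1..real n + real m + cot \<epsilon>} \<times> {1..real n + 1}"
      using detour_embedding_exists[OF G S mu eps] nm by blast
    have "drawing_area V E \<mu> D \<le> C * (real n * (real m + cot \<epsilon>))"
      if K: "real n \<le> K * (real m + cot \<epsilon>) + 1"
    proof (cases "n = 0")
      \<comment> \<open>Without vertices the area is 0 by convention. This case is separate because
        the right bound \<open>n + m + cot \<epsilon>\<close> of the enclosing rectangle may be
        below 1 there.\<close>
      case True
      then have "drawing_points V E \<mu> D = {}"
        using G nm by (fastforce simp: drawing_points_def simple_graph_def)
      then show ?thesis using True by (simp add: drawing_area_def bounding_box_area_def)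
    next
      case False
      have "drawing_area V E \<mu> D \<le> (real n + real m + cot \<epsilon> - 1) * real n"
        unfolding drawing_area_def using False cot 
        by (intro order_trans[OF bounding_box_area_le[OF D(2)]]) auto
      \<comment> \<open>The assumption replaces \<open>n - 1\<close> by
        \<open>K * (m + cot \<epsilon>)\<close>; the rest of the width is
        \<open>m + cot \<epsilon>\<close> itself.\<close>
      also have "\<dots> \<le> ((K + 1) * (real m + cot \<epsilon>)) * real n"
        using K by (intro mult_right_mono) (auto simp: algebra_simps)
      also have "\<dots> \<le> (C * (real m + cot \<epsilon>)) * real n"
        using C cot by (intro mult_right_mono) auto
      finally show ?thesis by (simp add: mult_ac)
    qed
    then show "\<exists>D. aac_embedding (pi / 2 - \<epsilon>) 2 V E \<mu> D \<and>
        (real n \<le> K * (real m + cot \<epsilon>) + 1 \<longrightarrow>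
           drawing_area V E \<mu> D \<le> C * (real n * (real m + cot \<epsilon>)))"
      using D(1) by blast
  qed
qed

end
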